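(* Let $A\in\mathbb{R}^{m\times n}$, $b\in\mathbb{R}^m$, $N=\{1,\dots,n\}$, and let $\mathcal{P}$ be the set of all $n\times n$ permutation matrices. Consider the R-UTVLD-LP $\min\{c^Tx : Gx\in P\ \ \forall G\in\mathcal{P}^*\}$ with $P=\{x\in\mathbb{R}^n\mid Ax\le b\}$ and $c\in\mathbb{R}^n$, where $\mathcal{P}^*$ is the set of all finite products of matrices from $\mathcal{P}$. Then its feasible set $\mathcal{S}=\{x\in\mathbb{R}^n \mid AGx\le b\ \ \forall G\in\mathcal{P}^*\}$ can be written as $$\mathcal{S}=\Big\{x\in\mathbb{R}^n\ \Big|\ \exists\, u^1,\dots,u^m,w^1,\dots,w^m\in\mathbb{R}^n:\ \sum_{i\in N}u_i^k+\sum_{j\in N}w_j^k\le b_k\ \ \forall k\in\{1,\dots,m\},\ \ u_i^k+w_j^k\ge A_{ki}x_j\ \ \forall i,j\in N,\ k\in\{1,\dots,m\}\Big\}.$$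
   Context: Inequalities between vectors are entrywise. A permutation matrix is a square $0/1$ matrix with exactly one nonzero entry in each row and each column. R-UTVLD-LP stands for robust to uncertain and time-varying linear dynamics linear program. The empty product (identity) is included in $\mathcal{P}^*$. *)

theory Defs
  imports "HOL-Analysis.Analysis"
begin

definition permutation_matrix :: "real^'n^'n \<Rightarrow> bool" where
  "permutation_matrix G \<longleftrightarrow>
     (\<forall>i j. G $ i $ j \<in> {0, 1}) \<and>
     (\<forall>i. \<exists>!j. G $ i $ j \<noteq> 0) \<and>
     (\<forall>j. \<exists>!i. G $ i $ j \<noteq> 0)"

text \<open>The set \<open>\<G>\<^sup>*\<close> of all finite products of matrices from \<open>\<G>\<close>;
  the empty list gives the empty product, i.e. the identity.\<close>

definition finite_products :: "(real^'n^'n) set \<Rightarrow> (real^'n^'n) set" where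
  "finite_products \<G> = {foldr (**) Gs (mat 1) | Gs. set Gs \<subseteq> \<G>}"

text \<open>A linear program robust to uncertain and time-varying linear dynamics (R-UTVLD-LP):
  minimise \<open>c \<bullet> x\<close> over all \<open>x\<close> such that \<open>G *v x \<in> P\<close> for every
  \<open>G \<in> \<G>\<^sup>*\<close>. The program is recorded by its data \<open>c\<close>, \<open>P\<close> and \<open>\<G>\<close>.\<close>

record 'n r_utvld_lp =
  lp_cost :: "real^'n"
  lp_polyhedron :: "(real^'n) set"
  lp_dynamics :: "(real^'n^'n) set"

definition lp_feasible_set :: "('n::finite) r_utvld_lp \<Rightarrow> (real^'n) set" where
  "lp_feasible_set L = {x. \<forall>G \<in> finite_products (lp_dynamics L). G *v x \<in> lp_polyhedron L}"

text \<open>In \<open>A *v x \<le> b\<close> the order on \<open>real^'m\<close> is the library's entrywise order.\<close>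

definition polyhedron_of :: "real^'n^'m \<Rightarrow> real^'m \<Rightarrow> (real^'n) set" where
  "polyhedron_of A b = {x. A *v x \<le> b}"

end

theory Submission
  imports Defs
begin

text \<open>
  A product of permutation matrices acts on a vector by permuting its coordinates, so \<open>x\<close> is
  feasible iff for each row \<open>a\<close> of \<open>A\<close>, with right-hand side \<open>\<beta>\<close>, the bound
  \<open>(\<Sum>i. a i * x (\<sigma> i)) \<le> \<beta>\<close> holds for all permutations \<open>\<sigma>\<close>. The largest of these sums is
  the value of an assignment problem with the rank-one profit \<open>a i * x j\<close>, and the pairs
  \<open>(u, w)\<close> with \<open>u i + w j \<ge> a i * x j\<close> are the feasible points of its linear programming
  dual. The theorem is thus linear programming duality for assignment problems, applied to one row
  at a time.

  Weak duality is the summation of the dual constraints along a permutation. Conversely, that some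
  dual point attains the largest sum over permutations rests, for general profits, on the
  integrality of the Birkhoff polytope together with linear programming duality; a rank-one
  profit allows an elementary construction: an optimal assignment matches large entries of
  \<open>a\<close> with large entries of \<open>x\<close>, and optimal potentials are obtained by adding the pairs in
  increasing order
  (lemma \<open>rank_one_assignment_potentials\<close>).
\<close>

text \<open>The induction removes maximisers \<open>p\<close> of \<open>a\<close> and \<open>q\<close> of \<open>x\<close> and matches them with each other.
  Tightness prescribes \<open>u p + w q\<close>, so the only freedom is \<open>c = w q\<close>: the inequalities between \<open>q\<close>
  and the old \<open>i\<close> bound \<open>c\<close> from below, those between \<open>p\<close> and the old \<open>j\<close> bound it from above. The
  bounds are compatible because \<open>(a p - a i) * (x q - x j) \<ge> 0\<close>.\<close>

lemma rank_one_assignment_potentials: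
  fixes a :: "'a \<Rightarrow> real" and x :: "'b \<Rightarrow> real"
  assumes "finite I" "finite J" "card I = card J"
  obtains \<sigma> u w where "bij_betw \<sigma> I J"
    and "\<And>i j. i \<in> I \<Longrightarrow> j \<in> J \<Longrightarrow> a i * x j \<le> u i + w j"
    and "\<And>i. i \<in> I \<Longrightarrow> u i + w (\<sigma> i) = a i * x (\<sigma> i)"
proof -
  have "\<exists>\<sigma> u w. bij_betw \<sigma> I J \<and> (\<forall>i\<in>I. \<forall>j\<in>J. a i * x j \<le> u i + w j)
          \<and> (\<forall>i\<in>I. u i + w (\<sigma> i) = a i * x (\<sigma> i))"
    using assms
  proof (induction "card I" arbitrary: I J)
    case 0
    then have "I = {}" "J = {}" by auto
    then show ?case by (auto simp: bij_betw_def)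
  next
    case (Suc n)
    have ne: "I \<noteq> {}" "J \<noteq> {}" using Suc by auto
    obtain p where p: "p \<in> I" "\<And>i. i \<in> I \<Longrightarrow> a i \<le> a p"
      using obtains_MAX[OF Suc.prems(1) ne(1), of a] Max_ge[OF finite_imageI[OF Suc.prems(1)]]
      by (metis imageI)
    obtain q where q: "q \<in> J" "\<And>j. j \<in> J \<Longrightarrow> x j \<le> x q"
      using obtains_MAX[OF Suc.prems(2) ne(2), of x] Max_ge[OF finite_imageI[OF Suc.prems(2)]]
      by (metis imageI)
    let ?I = "I - {p}" and ?J = "J - {q}"
    have "n = card ?I" "card ?I = card ?J"
      using Suc.hyps(2) Suc.prems p q by simp_all
    then obtain \<sigma> u w where \<sigma>: "bij_betw \<sigma> ?I ?J"
      and dual: "\<And>i j. i \<in> ?I \<Longrightarrow> j \<in> ?J \<Longrightarrow> a i * x j \<le> u i + w j"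
      and tight: "\<And>i. i \<in> ?I \<Longrightarrow> u i + w (\<sigma> i) = a i * x (\<sigma> i)"
      using Suc.hyps(1)[of ?I ?J] Suc.prems by (metis finite_Diff)
    obtain c where c_ge: "\<And>i. i \<in> ?I \<Longrightarrow> a i * x q - u i \<le> c"
      and c_le: "\<And>j. j \<in> ?J \<Longrightarrow> c \<le> a p * x q - a p * x j + w j"
    proof (cases "?I = {}")
      case True
      then have "?J = {}" using \<open>card ?I = card ?J\<close> Suc.prems by (metis card_0_eq finite_Diff)
      \<comment> \<open>With nothing left to bound it, \<open>c\<close> is arbitrary.\<close>
      then show ?thesis using that[of 0] True by auto
    next
      case False
      let ?c = "Max ((\<lambda>i. a i * x q - u i) ` ?I)"
      show ?thesis
      proof (rule that)
        show "a i * x q - u i \<le> ?c" if "i \<in> ?I" for i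
          using that Suc.prems by (intro Max_ge) auto
        show "?c \<le> a p * x q - a p * x j + w j" if j: "j \<in> ?J" for j
        proof -
          have "a i * x q - u i \<le> a p * x q - a p * x j + w j" if i: "i \<in> ?I" for i
          proof -
            have "0 \<le> (a p - a i) * (x q - x j)"
              using p q i j by (intro mult_nonneg_nonneg) auto
            then show ?thesis using dual[OF i j] by (simp add: algebra_simps)
          qed
          then show ?thesis using False Suc.prems by (subst Max_le_iff) auto
        qed
      qed
    qed
    let ?\<sigma> = "\<sigma>(p := q)" and ?u = "u(p := a p * x q - c)" and ?w = "w(q := c)"
    have "bij_betw ?\<sigma> ?I ?J"
      using \<sigma> by (subst bij_betw_cong[of _ _ \<sigma>]) auto
    then have "bij_betw ?\<sigma> (insert p ?I) (insert q ?J)"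
      using notIn_Un_bij_betw[of p ?I ?\<sigma> ?J] by simp
    then have "bij_betw ?\<sigma> I J"
      using p q by (simp add: insert_absorb)
    moreover have "\<forall>i\<in>I. \<forall>j\<in>J. a i * x j \<le> ?u i + ?w j"
      using dual c_ge c_le by (auto simp: algebra_simps)
    moreover have "\<forall>i\<in>I. ?u i + ?w (?\<sigma> i) = a i * x (?\<sigma> i)"
      using tight \<sigma> by (auto simp: bij_betw_def)
    ultimately show ?case by blast
  qed
  then show ?thesis using that by blast
qed

lemma permutation_matrix_acts:
  fixes G :: "real^'n^'n"
  assumes "permutation_matrix G"
  obtains \<sigma> where "bij \<sigma>" and "\<And>x i. (G *v x) $ i = x $ \<sigma> i"
proof -
  define \<sigma> where "\<sigma> i = (THE j. G $ i $ j \<noteq> 0)" for i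
  have row: "\<exists>!j. G $ i $ j \<noteq> 0" and col: "\<exists>!j. G $ j $ i \<noteq> 0"
    and G01: "G $ i $ j \<in> {0, 1}" for i j
    using assms by (simp_all add: permutation_matrix_def)
  have nz: "G $ i $ j \<noteq> 0 \<longleftrightarrow> j = \<sigma> i" for i j
    unfolding \<sigma>_def using theI'[OF row[of i]] the1_equality[OF row[of i]] by blast
  have G_eq: "G $ i $ j = (if j = \<sigma> i then 1 else 0)" for i j
    using nz[of i j] G01[of i j] by auto
  have "bij \<sigma>"
    using col by (intro bij_iff[THEN iffD2] allI) (simp only: nz eq_commute[of _ "\<sigma> _"])
  moreover have "(G *v x) $ i = x $ \<sigma> i" for x i
    by (simp add: matrix_vector_mult_def G_eq if_distrib[of "\<lambda>t. t * _"] cong: if_cong)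
  ultimately show ?thesis using that by blast
qed

lemma finite_product_of_permutation_matrices_acts:
  fixes G :: "real^'n^'n"
  assumes "G \<in> finite_products {G. permutation_matrix G}"
  obtains \<sigma> where "bij \<sigma>" and "\<And>x i. (G *v x) $ i = x $ \<sigma> i"
proof -
  obtain Gs where Gs: "G = foldr (**) Gs (mat 1)" "\<forall>H\<in>set Gs. permutation_matrix H"
    using assms unfolding finite_products_def by auto
  from Gs(2) have "\<exists>\<sigma>. bij \<sigma> \<and> (\<forall>x i. (foldr (**) Gs (mat 1) *v x) $ i = x $ \<sigma> i)"
  proof (induction Gs)
    case Nil
    then show ?case by (intro exI[of _ id]) (simp only: bij_id, simp)
  next
    case (Cons H Gs)
    obtain \<sigma> where \<sigma>: "bij \<sigma>" "\<And>x i. (foldr (**) Gs (mat 1) *v x) $ i = x $ \<sigma> i"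
      using Cons by auto
    obtain \<tau> where \<tau>: "bij \<tau>" "\<And>x i. (H *v x) $ i = x $ \<tau> i"
      using Cons.prems permutation_matrix_acts[of H] by auto
    have "bij (\<sigma> \<circ> \<tau>)" using \<sigma> \<tau> by (simp only: bij_comp)
    then show ?case
      using \<sigma>(2) \<tau>(2)
      by (intro exI[of _ "\<sigma> \<circ> \<tau>"] conjI) (assumption, simp add: matrix_vector_mul_assoc[symmetric])
  qed
  then show ?thesis using Gs(1) that by blast
qed

lemma permutation_matrix_of_bij:
  assumes "bij \<sigma>"
  shows "permutation_matrix (\<chi> i j. if j = \<sigma> i then 1 else 0)"
proof -
  have "\<exists>!i. j = \<sigma> i" for j
    using assms unfolding bij_iff by (simp only: eq_commute[of j])
  then show ?thesis by (simp add: permutation_matrix_def)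
qed

lemma permutation_matrix_in_finite_products:
  assumes "permutation_matrix G"
  shows "G \<in> finite_products {G. permutation_matrix G}"
  unfolding finite_products_def using assms by (auto intro!: exI[of _ "[G]"])

text \<open>Permutation matrices are closed under products, so \<open>\<P>\<^sup>*\<close> contains nothing beyond single
  permutation matrices, and the robust constraint splits into scalar ones.\<close>

lemma robust_constraint_iff_permutations:
  fixes A :: "real^'n^'m" and b :: "real^'m" and x :: "real^'n"
  shows "(\<forall>G \<in> finite_products {G. permutation_matrix G}. A *v (G *v x) \<le> b) \<longleftrightarrow>
         (\<forall>k \<sigma>. bij \<sigma> \<longrightarrow> (\<Sum>i\<in>UNIV. A $ k $ i * x $ \<sigma> i) \<le> b $ k)" (is "?L \<longleftrightarrow> ?R")
proof
  assume L: ?L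
  show ?R
  proof (intro allI impI)
    fix k and \<sigma> :: "'n \<Rightarrow> 'n" assume \<sigma>: "bij \<sigma>"
    let ?G = "(\<chi> i j. if j = \<sigma> i then 1 else 0) :: real^'n^'n"
    have "(?G *v x) $ i = x $ \<sigma> i" for i
      by (simp add: matrix_vector_mult_def if_distrib[of "\<lambda>t. t * _"] cong: if_cong)
    moreover have "(A *v (?G *v x)) $ k \<le> b $ k"
      using L permutation_matrix_in_finite_products[OF permutation_matrix_of_bij[OF \<sigma>]]
      by (simp add: less_eq_vec_def)
    ultimately show "(\<Sum>i\<in>UNIV. A $ k $ i * x $ \<sigma> i) \<le> b $ k"
      by (simp add: matrix_vector_mult_def[of A])
  qed
next
  assume R: ?R
  show ?L
  proof
    fix G :: "real^'n^'n" assume "G \<in> finite_products {G. permutation_matrix G}"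
    then obtain \<sigma> where "bij \<sigma>" "\<And>x i. (G *v x) $ i = x $ \<sigma> i"
      using finite_product_of_permutation_matrices_acts by blast
    then show "A *v (G *v x) \<le> b"
      using R by (simp add: less_eq_vec_def matrix_vector_mult_def[of A])
  qed
qed

text \<open>A tight dual pair along one bijection \<open>\<sigma>\<close> has total weight equal to the profit of \<open>\<sigma>\<close>, so a
  bound on the profits of all bijections transfers to the dual pair. Conversely, the total weight
  of any dual pair can be regrouped along any \<open>\<sigma>\<close> and then dominates the profit of \<open>\<sigma>\<close>.\<close>

lemma rank_one_assignment_duality:
  fixes a x :: "real^'n"
  shows "(\<forall>\<sigma>. bij \<sigma> \<longrightarrow> (\<Sum>i\<in>UNIV. a $ i * x $ \<sigma> i) \<le> \<beta>) \<longleftrightarrow>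
         (\<exists>u w :: real^'n. (\<Sum>i\<in>UNIV. u $ i) + (\<Sum>j\<in>UNIV. w $ j) \<le> \<beta> \<and>
            (\<forall>i j. u $ i + w $ j \<ge> a $ i * x $ j))" (is "?L \<longleftrightarrow> ?R")
proof
  assume L: ?L
  obtain \<sigma> u w where \<sigma>: "bij \<sigma>"
    and dual: "\<And>i j. a $ i * x $ j \<le> u i + w j"
    and tight: "\<And>i. u i + w (\<sigma> i) = a $ i * x $ \<sigma> i"
    by (rule rank_one_assignment_potentials[of "UNIV :: 'n set" "UNIV :: 'n set" "($) a" "($) x"])
      auto
  have "(\<Sum>i\<in>UNIV. u i) + (\<Sum>j\<in>UNIV. w j) = (\<Sum>i\<in>UNIV. u i + w (\<sigma> i))"
    using sum.reindex_bij_betw[OF \<sigma>, of w] by (simp add: sum.distrib)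
  also have "\<dots> \<le> \<beta>"
    using L \<sigma> by (simp add: tight)
  finally show ?R
    using dual by (intro exI[of _ "\<chi> i. u i"] exI[of _ "\<chi> j. w j"]) simp
next
  assume ?R
  then obtain u w :: "real^'n" where sum_le: "(\<Sum>i\<in>UNIV. u $ i) + (\<Sum>j\<in>UNIV. w $ j) \<le> \<beta>"
    and dual: "\<And>i j. a $ i * x $ j \<le> u $ i + w $ j"
    by auto
  show ?L
  proof (intro allI impI)
    fix \<sigma> :: "'n \<Rightarrow> 'n" assume \<sigma>: "bij \<sigma>"
    have "(\<Sum>i\<in>UNIV. a $ i * x $ \<sigma> i) \<le> (\<Sum>i\<in>UNIV. u $ i + w $ \<sigma> i)"
      by (intro sum_mono dual)
    also have "\<dots> = (\<Sum>i\<in>UNIV. u $ i) + (\<Sum>j\<in>UNIV. w $ j)"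
      using sum.reindex_bij_betw[OF \<sigma>, of "($) w"] by (simp add: sum.distrib)
    finally show "(\<Sum>i\<in>UNIV. a $ i * x $ \<sigma> i) \<le> \<beta>" using sum_le by simp
  qed
qed

theorem theorem3p8:
  fixes A :: "real^'n^'m" and b :: "real^'m" and c :: "real^'n"
    and L :: "'n r_utvld_lp" and S :: "(real^'n) set"
  defines "L \<equiv> \<lparr> lp_cost = c, lp_polyhedron = polyhedron_of A b,
                  lp_dynamics = {G. permutation_matrix G} \<rparr>"
    and "S \<equiv> {x. \<forall>G \<in> finite_products {G. permutation_matrix G}. A *v (G *v x) \<le> b}"
  shows "lp_feasible_set L = S \<and>
    S = {x. \<exists>(u :: 'm \<Rightarrow> real^'n) (w :: 'm \<Rightarrow> real^'n).
           (\<forall>k. (\<Sum>i\<in>UNIV. u k $ i) + (\<Sum>j\<in>UNIV. w k $ j) \<le> b $ k) \<and>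
           (\<forall>i j k. u k $ i + w k $ j \<ge> A $ k $ i * x $ j)}"
proof
  show "lp_feasible_set L = S"
    unfolding L_def S_def lp_feasible_set_def polyhedron_of_def by simp
  let ?D = "\<lambda>x k (u :: real^'n) (w :: real^'n).
    (\<Sum>i\<in>UNIV. u $ i) + (\<Sum>j\<in>UNIV. w $ j) \<le> b $ k \<and> (\<forall>i j. u $ i + w $ j \<ge> A $ k $ i * x $ j)"
  have "S = {x. \<forall>k. \<exists>u w. ?D x k u w}"
    unfolding S_def robust_constraint_iff_permutations
    by (simp only: rank_one_assignment_duality)
  also have "\<dots> = {x. \<exists>u w. \<forall>k. ?D x k (u k) (w k)}"
    by (simp only: choice_iff)
  finally show "S = {x. \<exists>(u :: 'm \<Rightarrow> real^'n) (w :: 'm \<Rightarrow> real^'n).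
           (\<forall>k. (\<Sum>i\<in>UNIV. u k $ i) + (\<Sum>j\<in>UNIV. w k $ j) \<le> b $ k) \<and>
           (\<forall>i j k. u k $ i + w k $ j \<ge> A $ k $ i * x $ j)}"
    by blast
qed

end
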